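(* Let $\ell$ be a prime with $\ell\equiv 11\bmod 12$, let $f(q)=(\eta(q)\eta(q^\ell))^2$ where $\eta$ is Dedekind's function, and let $U_\ell^a=U_\ell^a(X,Y,Z)$ be the modular polynomial of $f$ written in terms of $E_4,E_6$, so that $U_\ell^a(f,E_4,E_6)=0$. Put $\tilde E_4=E_4(q^\ell)$. Let $\partial_f,\partial_4,\partial_6$ denote the first partial derivatives of $U_\ell^a$ with respect to its first, second and third variable, and $\partial_{f4},\partial_{f6},\partial_{46}$ the corresponding mixed second partial derivatives, all evaluated at $(f,E_4,E_6)$. Then $$\tilde E_4=-\,\frac{M}{\ell^2\,f^2\,E_4\,E_6\,\partial_f^3},$$ where $$\begin{aligned} M={}&24\,(3E_6\partial_6^2\partial_{f4}+\partial_{46}\partial_f^2 f)\,E_4^6\\ &+12\,\bigl(9E_6^2\partial_6^2\partial_{f6}-3E_6\partial_6^2\partial_f\ell+6E_6\partial_6\partial_f\partial_{f6}f-\partial_6\partial_f^2\ell f+\partial_f^2\partial_{f6}f^2-6E_6\partial_6^2\partial_f+2\partial_6\partial_f^2 f\bigr)\,E_4^5\\ &+96\,E_4^4E_6^2\,\partial_4\partial_6\partial_{f4}\\ &+4E_6\,\bigl(36E_6^2\partial_4\partial_6\partial_{f6}-12E_6\partial_4\partial_6\partial_f\ell+12E_6\partial_4\partial_f\partial_{f6}f-12E_6\partial_{46}\partial_f^2 f\\ &\qquad\quad+12E_6\partial_6\partial_f\partial_{f4}f-24E_6\partial_4\partial_6\partial_f-5\partial_4\partial_f^2 f\bigr)\,E_4^3\\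 &+E_6\,\bigl(32E_6^2\partial_4^2\partial_{f4}-42E_6\partial_6\partial_f^2 f+\partial_f^3f^2\bigr)\,E_4^2\\ &+16E_6^3\partial_4\,\bigl(3E_6\partial_4\partial_{f6}-\partial_4\partial_f\ell+2\partial_f\partial_{f4}f-2\partial_4\partial_f\bigr)\,E_4\\ &+24E_6^4\partial_{46}f\partial_f^2-8E_6^3\partial_4\ell f\partial_f^2+8E_6^3\partial_{f4}f^2\partial_f^2+8E_6^3\partial_4 f\partial_f^2. \end{aligned}$$
   Context: Here $q=\exp(2i\pi\tau)$, and $E_4(q)=1+240\sum_{n\ge1}\delta_3(n)q^n$, $E_6(q)=1-504\sum_{n\ge1}\delta_5(n)q^n$, where $\delta_r(n)$ is the sum of the $r$-th powers of the divisors of $n$; $E_k=E_k(q)$. Also $\eta(q)=q^{1/24}\prod_{n\ge1}(1-q^n)$, so that $\eta^{24}=\Delta=(E_4^3-E_6^2)/1728$. For $\ell\equiv11\bmod12$, $f$ is a modular form of weight $2$ for $\Gamma_0(\ell)$. The polynomial $U_\ell^a(X,Y,Z)$ with rational coefficients is the polynomial, monic of degree $\ell+1$ in $X$, such that $U_\ell^a(f,E_4,E_6)=0$ (it is the minimal polynomial of $f$ over $\mathbb{Q}(E_4,E_6)$; any occurrence of $\Delta$ in its coefficients is replaced by $(E_4^3-E_6^2)/1728$). Assigning weights $1,2,3$ to $X,Y,Z$, it is weighted homogeneous of degree $\ell+1$. The identity is one of (quotients of) power series in $q$; $\partial_f$ is a nonzero series since $U_\ell^a$ is the minimal polynomial of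 $f$. *)

theory Defs
  imports
    "HOL-Analysis.Infinite_Products"
    "HOL-Computational_Algebra.Computational_Algebra"
    "HOL-Number_Theory.Cong"
begin

text \<open>
  All series are formal power series over the rationals in \<open>t = q\<^bsup>1/24\<^esup>\<close>, the
  indeterminate \<^const>\<open>fps_X\<close>, because \<open>\<eta>\<close> is a power series in \<open>t\<close> but not in \<open>q\<close>.
\<close>

definition q_ser :: "rat fps"
  where "q_ser = fps_X ^ 24"

definition divisor_power_sum :: "nat \<Rightarrow> nat \<Rightarrow> nat"
  where "divisor_power_sum r n = (\<Sum>d | d dvd n. d ^ r)"

definition E4_ser :: "rat fps"
  where "E4_ser = 1 + 240 *
    (Abs_fps (\<lambda>n. if n = 0 then 0 else of_nat (divisor_power_sum 3 n)) oo q_ser)"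

definition E6_ser :: "rat fps"
  where "E6_ser = 1 - 504 *
    (Abs_fps (\<lambda>n. if n = 0 then 0 else of_nat (divisor_power_sum 5 n)) oo q_ser)"

text \<open>The infinite product is taken in the \<open>t\<close>-adic topology of \<^typ>\<open>rat fps\<close>.\<close>

definition eta_ser :: "rat fps"
  where "eta_ser = fps_X * prodinf (\<lambda>n. 1 - q_ser ^ Suc n)"

text \<open>\<open>F(q) \<mapsto> F(q\<^sup>l)\<close>; in terms of \<open>t\<close> this is \<open>t \<mapsto> t\<^sup>l\<close>.\<close>

definition q_power :: "nat \<Rightarrow> rat fps \<Rightarrow> rat fps"
  where "q_power l F = F oo (fps_X ^ l)"

definition f_ser :: "nat \<Rightarrow> rat fps"
  where "f_ser l = (eta_ser * q_power l eta_ser) ^ 2"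


text \<open>
  A polynomial in \<open>\<rat>[X,Y,Z]\<close> is an element of \<open>\<rat>[Z][Y][X]\<close>: the outermost variable is \<open>X\<close>,
  the innermost one is \<open>Z\<close>. Likewise \<^typ>\<open>rat poly poly\<close> is \<open>\<rat>[Z][Y]\<close>.
\<close>

definition eval_YZ :: "rat poly poly \<Rightarrow> 'a::field_char_0 \<Rightarrow> 'a \<Rightarrow> 'a"
  where "eval_YZ c y z = poly (map_poly (\<lambda>d. poly (map_poly of_rat d) z) c) y"

definition specialize_YZ :: "rat poly poly poly \<Rightarrow> 'a::field_char_0 \<Rightarrow> 'a \<Rightarrow> 'a poly"
  where "specialize_YZ U y z = map_poly (\<lambda>c. eval_YZ c y z) U"

definition eval_XYZ :: "rat poly poly poly \<Rightarrow> 'a::field_char_0 \<Rightarrow> 'a \<Rightarrow> 'a \<Rightarrow> 'a"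
  where "eval_XYZ U x y z = poly (specialize_YZ U y z) x"

definition partial_X :: "rat poly poly poly \<Rightarrow> rat poly poly poly"
  where "partial_X U = pderiv U"

definition partial_Y :: "rat poly poly poly \<Rightarrow> rat poly poly poly"
  where "partial_Y U = map_poly pderiv U"

definition partial_Z :: "rat poly poly poly \<Rightarrow> rat poly poly poly"
  where "partial_Z U = map_poly (map_poly pderiv) U"

definition weighted_homogeneous :: "nat \<Rightarrow> rat poly poly poly \<Rightarrow> bool"
  where "weighted_homogeneous d U \<longleftrightarrow>
    (\<forall>i j k. coeff (coeff (coeff U i) j) k \<noteq> 0 \<longrightarrow> 1 * i + 2 * j + 3 * k = d)"


text \<open>The subfield \<open>\<rat>(y, z)\<close> of a field of characteristic 0.\<close>

definition rat_adjoin2 :: "'a::field_char_0 \<Rightarrow> 'a \<Rightarrow> 'a set"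
  where "rat_adjoin2 y z = {eval_YZ A y z / eval_YZ B y z | A B. eval_YZ B y z \<noteq> 0}"

definition is_minimal_polynomial :: "'a::field set \<Rightarrow> 'a \<Rightarrow> 'a poly \<Rightarrow> bool"
  where "is_minimal_polynomial K x p \<longleftrightarrow>
    (\<forall>i. coeff p i \<in> K) \<and> lead_coeff p = 1 \<and> poly p x = 0 \<and>
    (\<forall>r. r \<noteq> 0 \<and> (\<forall>i. coeff r i \<in> K) \<and> poly r x = 0 \<longrightarrow> degree p \<le> degree r)"

text \<open>
  \<open>U\<close> is the modular polynomial \<open>U\<^sub>l\<^sup>a\<close> of \<open>f\<close>. The conditions determine \<open>U\<close> uniquely, since
  \<open>E\<^sub>4\<close> and \<open>E\<^sub>6\<close> are algebraically independent over \<open>\<rat>\<close>. The ambient field is that of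
  formal Laurent series in \<open>t\<close>, the fraction field of \<^typ>\<open>rat fps\<close>.
\<close>

definition modular_polynomial :: "nat \<Rightarrow> rat poly poly poly \<Rightarrow> bool"
  where "modular_polynomial l U \<longleftrightarrow>
    (let f = fps_to_fls (f_ser l); E4 = fps_to_fls E4_ser; E6 = fps_to_fls E6_ser in
      degree U = l + 1 \<and> lead_coeff U = 1 \<and>
      eval_XYZ U f E4 E6 = 0 \<and>
      is_minimal_polynomial (rat_adjoin2 E4 E6) f (specialize_YZ U E4 E6) \<and>
      weighted_homogeneous (l + 1) U)"

end

theory Submission
  imports Defs
begin

unbundle no vec_syntax

text \<open>
  Let \<open>D = q d/dq\<close>. Differentiating \<open>U(f, E\<^sub>4, E\<^sub>6) = 0\<close> with Ramanujan's formulas for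
  \<open>D E\<^sub>2\<close>, \<open>D E\<^sub>4\<close>, \<open>D E\<^sub>6\<close>, with \<open>D \<eta> = \<eta> E\<^sub>2 / 24\<close> and with Euler's relation for the weighted
  homogeneous \<open>U\<close>, all multiples of \<open>E\<^sub>2\<close> combine and give
  \<open>l E\<^sub>2(q\<^sup>l) - E\<^sub>2 = (4 \<partial>\<^sub>4 E\<^sub>6 + 6 \<partial>\<^sub>6 E\<^sub>4\<^sup>2) / (f \<partial>\<^sub>f)\<close>. Differentiating once more brings in
  \<open>E\<^sub>4(q\<^sup>l)\<close>; the pure second derivatives of \<open>U\<close> are removed by Euler's relations for its
  first partial derivatives.

  Ramanujan's formulas are equivalent to convolution identities for divisor sums. Those follow
  from a bijection on the solutions of \<open>a x + b y = n\<close> applied to powers of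
  \<open>a\<^sup>2 + a b + b\<^sup>2\<close> and to \<open>(a b (a + b))\<^sup>2\<close>.
\<close>

section \<open>Convolution sums of divisor functions\<close>

text \<open>These index the coefficient of \<open>q^n\<close> in a product of two divisor-sum
  series: \<open>a\<close> divides \<open>a * x\<close>, \<open>b\<close> divides
  \<open>b * y\<close>.\<close>

definition quads :: "nat \<Rightarrow> (nat \<times> nat \<times> nat \<times> nat) set"
  where "quads n = {(a, b, x, y). 0 < a \<and> 0 < b \<and> 0 < x \<and> 0 < y \<and> a * x + b * y = n}"

lemma finite_quads: "finite (quads n)"
proof (rule finite_subset)
  show "quads n \<subseteq> {..n} \<times> {..n} \<times> {..n} \<times> {..n}"
  proof
    fix u assume "u \<in> quads n"
    then obtain a b x y where u: "u = (a, b, x, y)"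
      and pos: "0 < a" "0 < b" "0 < x" "0 < y" and n: "a * x + b * y = n"
      by (auto simp: quads_def)
    have "a \<le> a * x" "x \<le> a * x" "b \<le> b * y" "y \<le> b * y"
      using pos by auto
    then have "a \<le> n" "b \<le> n" "x \<le> n" "y \<le> n"
      using n by linarith+
    then show "u \<in> {..n} \<times> {..n} \<times> {..n} \<times> {..n}"
      unfolding u by simp
  qed
qed auto

lemma sum_quads_trichotomy:
  fixes G :: "nat \<Rightarrow> nat \<Rightarrow> nat \<Rightarrow> nat \<Rightarrow> 'a::comm_monoid_add"
    and p q :: "nat \<Rightarrow> nat \<Rightarrow> nat \<Rightarrow> nat \<Rightarrow> nat"
  shows "(\<Sum>(a,b,x,y)\<in>quads n. G a b x y) =
     (\<Sum>(a,b,x,y) | (a,b,x,y) \<in> quads n \<and> p a b x y < q a b x y. G a b x y)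
   + (\<Sum>(a,b,x,y) | (a,b,x,y) \<in> quads n \<and> q a b x y < p a b x y. G a b x y)
   + (\<Sum>(a,b,x,y) | (a,b,x,y) \<in> quads n \<and> p a b x y = q a b x y. G a b x y)"
  (is "?S = sum ?G ?A + sum ?G ?B + sum ?G ?C")
proof -
  have eq: "quads n = (?A \<union> ?B) \<union> ?C"
    by (auto simp: not_less_iff_gr_or_eq)
  have fin: "finite ?A" "finite ?B" "finite ?C"
    by (rule finite_subset[OF _ finite_quads[of n]]; auto)+
  have "?S = sum ?G ((?A \<union> ?B) \<union> ?C)"
    by (subst (1) eq) simp
  also have "\<dots> = sum ?G (?A \<union> ?B) + sum ?G ?C"
    by (rule sum.union_disjoint) (use fin in auto)
  also have "sum ?G (?A \<union> ?B) = sum ?G ?A + sum ?G ?B"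
    by (rule sum.union_disjoint) (use fin in auto)
  finally show ?thesis .
qed

lemma sum_quads_swap:
  "(\<Sum>(a,b,x,y) | (a,b,x,y) \<in> quads n \<and> P a b x y. G a b x y)
   = (\<Sum>(a,b,x,y) | (a,b,x,y) \<in> quads n \<and> P b a y x. G b a y x)"
  by (rule sum.reindex_bij_witness[where i = "\<lambda>(a,b,x,y). (b,a,y,x)"
        and j = "\<lambda>(a,b,x,y). (b,a,y,x)"])
     (auto simp: quads_def add.commute)

text \<open>\<open>(a + b) * x + b * (y - x) = a * x + b * y\<close>; the conditions
  \<open>x < y\<close> and \<open>b < a\<close> keep \<open>y - x\<close> and \<open>a - b\<close>
  positive.\<close>

lemma sum_quads_shear:
  "(\<Sum>(a,b,x,y) | (a,b,x,y) \<in> quads n \<and> x < y. G a b)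
   = (\<Sum>(a,b,x,y) | (a,b,x,y) \<in> quads n \<and> b < a. G (a - b) b)"
  by (rule sum.reindex_bij_witness[where i = "\<lambda>(a,b,x,y). (a - b, b, x, x + y)"
        and j = "\<lambda>(a,b,x,y). (a + b, b, x, y - x)"])
     (auto simp: quads_def add_mult_distrib diff_mult_distrib diff_mult_distrib2
        add_mult_distrib2)

text \<open>If \<open>x = y\<close> then \<open>(a + b) * x = n\<close>, so \<open>d = a + b\<close>
  runs through the divisors of \<open>n\<close>, and \<open>a\<close> from 1 to
  \<open>d - 1\<close>.\<close>

lemma sum_quads_diagonal_x:
  assumes "0 < n"
  shows "(\<Sum>(a,b,x,y) | (a,b,x,y) \<in> quads n \<and> x = y. G a b)
   = (\<Sum>d | d dvd n. \<Sum>a\<in>{1..<d}. G a (d - a))"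
proof -
  have "finite {d. d dvd n}" using assms by simp
  then have "(\<Sum>d | d dvd n. \<Sum>a\<in>{1..<d}. G a (d - a)) =
      (\<Sum>(d,a)\<in>(SIGMA d:{d. d dvd n}. {1..<d}). G a (d - a))"
    by (simp add: sum.Sigma)
  also have "\<dots> = (\<Sum>(a,b,x,y) | (a,b,x,y) \<in> quads n \<and> x = y. G a b)"
    by (rule sum.reindex_bij_witness[where i = "\<lambda>(a,b,x,y). (a + b, a)"
        and j = "\<lambda>(d,a). (a, d - a, n div d, n div d)"])
       (use assms in \<open>auto simp: quads_def simp flip: add_mult_distrib elim!: dvdE\<close>)
  finally show ?thesis by simp
qed

text \<open>If \<open>a = b = d\<close> then \<open>x + y = n / d\<close>, which has
  \<open>n / d - 1\<close> positive solutions.\<close>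

lemma sum_quads_diagonal_a:
  fixes G :: "nat \<Rightarrow> nat \<Rightarrow> rat"
  assumes "0 < n"
  shows "(\<Sum>(a,b,x,y) | (a,b,x,y) \<in> quads n \<and> a = b. G a b)
   = (\<Sum>d | d dvd n. (of_nat n / of_nat d - 1) * G d d)"
proof -
  have "(of_nat n / of_nat d - 1) * G d d = (\<Sum>x\<in>{1..<n div d}. G d d)" if "d dvd n" for d
    using that assms by (auto elim!: dvdE simp: of_nat_diff)
  then have "(\<Sum>d | d dvd n. (of_nat n / of_nat d - 1) * G d d)
      = (\<Sum>d | d dvd n. \<Sum>x\<in>{1..<n div d}. G d d)"
    by (intro sum.cong) auto
  also have "\<dots> = (\<Sum>(d,x)\<in>(SIGMA d:{d. d dvd n}. {1..<n div d}). G d d)"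
    by (rule sum.Sigma) (use assms in auto)
  also have "\<dots> = (\<Sum>(a,b,x,y) | (a,b,x,y) \<in> quads n \<and> a = b. G a b)"
    by (rule sum.reindex_bij_witness[where i = "\<lambda>(a,b,x,y). (a, x)"
        and j = "\<lambda>(d,x). (d, d, x, n div d - x)"])
       (use assms in \<open>auto simp: quads_def simp flip: add_mult_distrib2 elim!: dvdE\<close>)
  finally show ?thesis by simp
qed

text \<open>
  With \<open>K a b = H (a - b) b\<close>, the shear \<open>(a, b, x, y) \<mapsto> (a - b, b, x, x + y)\<close> preserves
  \<open>a x + b y\<close>, so the part of the sum of \<open>K\<close> with \<open>b < a\<close> equals the part of the sum of \<open>H\<close>
  with \<open>x < y\<close>. By symmetry each is half of the whole sum without its diagonal.
\<close>

lemma sum_quads_difference: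
  fixes H :: "rat \<Rightarrow> rat \<Rightarrow> rat"
  assumes "0 < n" and symH: "\<And>a b. H a b = H b a" and symK: "\<And>a b. H (a - b) b = H (b - a) a"
  shows "(\<Sum>(a,b,x,y)\<in>quads n. H (of_nat a) (of_nat b) - H (of_nat a - of_nat b) (of_nat b))
   = (\<Sum>d | d dvd n. (\<Sum>a\<in>{1..<d}. H (of_nat a) (of_nat d - of_nat a))
        - (of_nat n / of_nat d - 1) * H 0 (of_nat d))"
proof -
  let ?H = "\<lambda>a b::nat. H (of_nat a) (of_nat b)"
  let ?K = "\<lambda>a b::nat. H (of_nat a - of_nat b) (of_nat b)"
  let ?A = "\<Sum>(a,b,x,y) | (a,b,x,y) \<in> quads n \<and> b < a. ?K a b"
  have 1: "(\<Sum>(a,b,x,y) | (a,b,x,y) \<in> quads n \<and> x < y. ?H a b) = ?A"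
    by (subst sum_quads_shear) (intro sum.cong, auto simp: of_nat_diff)
  have 2: "(\<Sum>(a,b,x,y) | (a,b,x,y) \<in> quads n \<and> y < x. ?H a b) = ?A"
    by (subst sum_quads_swap, subst symH) (rule 1)
  have 3: "(\<Sum>(a,b,x,y) | (a,b,x,y) \<in> quads n \<and> a < b. ?K a b) = ?A"
    by (subst sum_quads_swap, subst symK) (rule refl)
  have 4: "(\<Sum>(a,b,x,y) | (a,b,x,y) \<in> quads n \<and> x = y. ?H a b)
      = (\<Sum>d | d dvd n. \<Sum>a\<in>{1..<d}. H (of_nat a) (of_nat d - of_nat a))"
    by (subst sum_quads_diagonal_x[OF assms(1)]) (auto intro!: sum.cong simp: of_nat_diff)
  have H: "(\<Sum>(a,b,x,y)\<in>quads n. ?H a b) = 2 * ?A +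
      (\<Sum>d | d dvd n. \<Sum>a\<in>{1..<d}. H (of_nat a) (of_nat d - of_nat a))"
    using sum_quads_trichotomy[of "\<lambda>a b x y. ?H a b" n "\<lambda>a b x y. x" "\<lambda>a b x y. y"]
    unfolding 1 2 4 by simp
  have K: "(\<Sum>(a,b,x,y)\<in>quads n. ?K a b) = 2 * ?A +
      (\<Sum>d | d dvd n. (of_nat n / of_nat d - 1) * H 0 (of_nat d))"
    using sum_quads_trichotomy[of "\<lambda>a b x y. ?K a b" n "\<lambda>a b x y. a" "\<lambda>a b x y. b"]
    unfolding 3 sum_quads_diagonal_a[OF assms(1)] by simp
  show ?thesis
    using H K by (simp add: sum_subtractf case_prod_unfold)
qed

definition divisor_series :: "nat \<Rightarrow> rat fps"
  where "divisor_series r = Abs_fps (\<lambda>n. if n = 0 then 0 else of_nat (divisor_power_sum r n))"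

lemma divisor_series_nth:
  "0 < n \<Longrightarrow> divisor_series r $ n = (\<Sum>d | d dvd n. of_nat d ^ r)"
  by (simp add: divisor_series_def divisor_power_sum_def)

lemma divisor_series_nth_0 [simp]: "divisor_series r $ 0 = 0"
  by (simp add: divisor_series_def)

text \<open>Cauchy product: choose divisors \<open>a\<close> of \<open>i\<close> and
  \<open>b\<close> of \<open>n - i\<close>; \<open>x\<close> and \<open>y\<close> are the cofactors.
  Zero constant terms remove \<open>i = 0\<close> and \<open>i = n\<close>.\<close>

lemma divisor_series_mult_nth:
  "(divisor_series r * divisor_series s) $ n
    = (\<Sum>(a,b,x,y)\<in>quads n. of_nat a ^ r * of_nat b ^ s)"
proof -
  have "(divisor_series r * divisor_series s) $ n
      = (\<Sum>i=0..n. divisor_series r $ i * divisor_series s $ (n - i))"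
    by (simp add: fps_mult_nth)
  also have "\<dots> = (\<Sum>i\<in>{0<..<n}. divisor_series r $ i * divisor_series s $ (n - i))"
    by (rule sum.mono_neutral_right) (auto simp: not_less intro: ccontr)
  also have "\<dots> = (\<Sum>i\<in>{0<..<n}. \<Sum>(a,b)\<in>{a. a dvd i} \<times> {b. b dvd n - i}.
      of_nat a ^ r * of_nat b ^ s)"
    by (intro sum.cong) (simp_all add: divisor_series_nth sum_product sum.cartesian_product)
  also have "\<dots> = (\<Sum>(i,a,b)\<in>(SIGMA i:{0<..<n}. {a. a dvd i} \<times> {b. b dvd n - i}).
      of_nat a ^ r * of_nat b ^ s)"
    by (subst sum.Sigma) (auto simp: case_prod_unfold)
  also have "\<dots> = (\<Sum>(a,b,x,y)\<in>quads n. of_nat a ^ r * of_nat b ^ s)"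
    by (rule sum.reindex_bij_witness[where i = "\<lambda>(a,b,x,y). (a * x, a, b)"
        and j = "\<lambda>(i,a,b). (a, b, i div a, (n - i) div b)"])
       (auto simp: quads_def elim!: dvdE intro!: Nat.gr0I split: if_splits)
  finally show ?thesis .
qed

section \<open>Power sums and the diagonal terms \<open>x = y\<close>\<close>

lemma sum_power_lessThan:
  fixes m :: nat
  defines "x \<equiv> of_nat m :: rat"
  shows "(\<Sum>a<m. (1::rat)) = x"
    "(\<Sum>a<m. of_nat a) = (x^2 - x) / 2"
    "(\<Sum>a<m. of_nat a ^ 2) = (2*x^3 - 3*x^2 + x) / 6"
    "(\<Sum>a<m. of_nat a ^ 3) = (x^4 - 2*x^3 + x^2) / 4"
    "(\<Sum>a<m. of_nat a ^ 4) = (6*x^5 - 15*x^4 + 10*x^3 - x) / 30"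
    "(\<Sum>a<m. of_nat a ^ 5) = (2*x^6 - 6*x^5 + 5*x^4 - x^2) / 12"
    "(\<Sum>a<m. of_nat a ^ 6) = (6*x^7 - 21*x^6 + 21*x^5 - 7*x^3 + x) / 42"
  unfolding x_def by (induction m; simp add: field_simps power_numeral_reduce power2_eq_square)+

lemma sum_atLeast1_lessThan:
  fixes g :: "nat \<Rightarrow> rat"
  assumes "0 < d"
  shows "(\<Sum>a\<in>{1..<d}. g a) = (\<Sum>a<d. g a) - g 0"
  using assms by (simp add: lessThan_atLeast0 sum.atLeast_Suc_lessThan)

text \<open>With \<open>a + b = d\<close>, the form \<open>a^2 + a b + b^2\<close> becomes
  \<open>d^2 - d a + a^2\<close>, and \<open>a b (a + b)\<close> becomes \<open>d a (d - a)\<close>.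
  The terms \<open>- x^2\<close>, \<open>- x^4\<close>, \<open>- x^6\<close> come from removing
  \<open>a = 0\<close> from the Faulhaber sums.\<close>

lemma diagonal_quadratic_form:
  fixes d :: nat
  defines "x \<equiv> of_nat d :: rat"
  assumes "0 < d"
  shows "(\<Sum>a\<in>{1..<d}. x^2 - x * of_nat a + of_nat a ^ 2) = 5/6 * x^3 - x^2 + x/6"
    "(\<Sum>a\<in>{1..<d}. (x^2 - x * of_nat a + of_nat a ^ 2)^2) = 7/10 * x^5 - x^4 + x^3/3 - x/30"
    "(\<Sum>a\<in>{1..<d}. (x^2 - x * of_nat a + of_nat a ^ 2)^3)
       = 83/140 * x^7 - x^6 + x^5/2 - 7/60 * x^3 + x/42"
    "(\<Sum>a\<in>{1..<d}. (x * of_nat a * (x - of_nat a))^2) = (x^7 - x^3) / 30"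
proof -
  \<comment> \<open>The bound \<open>m\<close> is separate from \<open>x\<close>, so that the
    induction leaves \<open>x\<close> fixed.\<close>
  have expand:
    "(\<Sum>a<m. x^2 - x * of_nat a + of_nat a ^ 2)
      = x^2 * (\<Sum>a<m. 1) - x * (\<Sum>a<m. of_nat a) + (\<Sum>a<m. of_nat a ^ 2)"
    "(\<Sum>a<m. (x^2 - x * of_nat a + of_nat a ^ 2)^2)
      = x^4 * (\<Sum>a<m. 1) - 2 * x^3 * (\<Sum>a<m. of_nat a) + 3 * x^2 * (\<Sum>a<m. of_nat a ^ 2)
        - 2 * x * (\<Sum>a<m. of_nat a ^ 3) + (\<Sum>a<m. of_nat a ^ 4)"
    "(\<Sum>a<m. (x^2 - x * of_nat a + of_nat a ^ 2)^3)
      = x^6 * (\<Sum>a<m. 1) - 3 * x^5 * (\<Sum>a<m. of_nat a) + 6 * x^4 * (\<Sum>a<m. of_nat a ^ 2)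
        - 7 * x^3 * (\<Sum>a<m. of_nat a ^ 3) + 6 * x^2 * (\<Sum>a<m. of_nat a ^ 4)
        - 3 * x * (\<Sum>a<m. of_nat a ^ 5) + (\<Sum>a<m. of_nat a ^ 6)"
    "(\<Sum>a<m. (x * of_nat a * (x - of_nat a))^2)
      = x^4 * (\<Sum>a<m. of_nat a ^ 2) - 2 * x^3 * (\<Sum>a<m. of_nat a ^ 3)
        + x^2 * (\<Sum>a<m. of_nat a ^ 4)" for m
    by (induction m; simp add: power_numeral_reduce algebra_simps)+
  show "(\<Sum>a\<in>{1..<d}. x^2 - x * of_nat a + of_nat a ^ 2) = 5/6 * x^3 - x^2 + x/6"
    "(\<Sum>a\<in>{1..<d}. (x^2 - x * of_nat a + of_nat a ^ 2)^2) = 7/10 * x^5 - x^4 + x^3/3 - x/30"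
    "(\<Sum>a\<in>{1..<d}. (x^2 - x * of_nat a + of_nat a ^ 2)^3)
       = 83/140 * x^7 - x^6 + x^5/2 - 7/60 * x^3 + x/42"
    "(\<Sum>a\<in>{1..<d}. (x * of_nat a * (x - of_nat a))^2) = (x^7 - x^3) / 30"
    unfolding sum_atLeast1_lessThan[OF \<open>0 < d\<close>] expand sum_power_lessThan x_def[symmetric]
    by (simp_all add: field_simps power_numeral_reduce)
qed

definition q_deriv :: "rat fps \<Rightarrow> rat fps"
  where "q_deriv F = fps_X * fps_deriv F"

lemma q_deriv_nth: "q_deriv F $ n = of_nat n * F $ n"
  by (cases n) (simp_all add: q_deriv_def)

text \<open>For the \<open>k\<close>-th power of the form, the diagonal term
  \<open>(n/d - 1) d^(2k)\<close> yields \<open>n * s (2k - 1)\<close>, a coefficient of a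
  derivative, and a \<open>d^(2k)\<close> that cancels the even power in the other diagonal sum. The
  last identity is \<open>E4^2 = E8\<close> on coefficients.\<close>

lemma divisor_convolution:
  fixes n :: nat
  assumes n: "0 < n"
  defines "s \<equiv> \<lambda>r. divisor_series r $ n"
    and "c \<equiv> \<lambda>r r'. (divisor_series r * divisor_series r') $ n"
  shows "2 * c 1 1 = 5/6 * s 3 + s 1 / 6 - of_nat n * s 1"
    and "8 * c 1 3 = 7/10 * s 5 + s 3 / 3 - s 1 / 30 - of_nat n * s 3"
    and "12 * c 1 5 + 14 * c 3 3 = 83/140 * s 7 + s 5 / 2 - 7/60 * s 3 + s 1 / 42 - of_nat n * s 5"
    and "4 * c 3 3 = (s 7 - s 3) / 30"
proof -
  have fin: "finite {d. d dvd n}"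
    using n by simp
  have pos: "0 < d" if "d dvd n" for d
    using that n by (rule dvd_pos_nat[rotated])
  have ssum: "s r = (\<Sum>d | d dvd n. of_nat d ^ r)" for r
    unfolding s_def by (rule divisor_series_nth[OF n])
  have csum: "c r r' = (\<Sum>(a,b,x,y)\<in>quads n. of_nat a ^ r * of_nat b ^ r')" for r r'
    unfolding c_def by (rule divisor_series_mult_nth)
  have csym: "c r r' = c r' r" for r r'
    unfolding c_def by (simp add: mult.commute)
  \<comment> \<open>\<open>e (a - b) b = e a (- b)\<close>, so differences of powers of
    \<open>e\<close> keep only monomials odd in both variables: convolutions of odd divisor
    sums.\<close>
  define e :: "rat \<Rightarrow> rat \<Rightarrow> rat" where "e a b = a^2 + a*b + b^2" for a b
  have e: "e a b = e b a" "e (a - b) b = e (b - a) a" "e 0 b = b^2" "e a (b - a) = b^2 - b*a + a^2" for a b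
    by (simp_all add: e_def power2_eq_square algebra_simps)
  have ediff: "e a b - e (a - b) b = 2 * (a^1 * b^1)"
    "e a b ^ 2 - e (a - b) b ^ 2 = 4 * (a^1 * b^3) + 4 * (a^3 * b^1)"
    "e a b ^ 3 - e (a - b) b ^ 3 = 6 * (a^1 * b^5) + 6 * (a^5 * b^1) + 14 * (a^3 * b^3)" for a b
    by (simp_all add: e_def power_numeral_reduce algebra_simps)

  have "2 * c 1 1 = (\<Sum>(a,b,x,y)\<in>quads n. e (of_nat a) (of_nat b) - e (of_nat a - of_nat b) (of_nat b))"
    unfolding csum ediff by (simp add: sum_distrib_left case_prod_unfold)
  also have "\<dots> = (\<Sum>d | d dvd n. 5/6 * of_nat d ^ 3 + of_nat d ^ 1 / 6 - of_nat n * of_nat d ^ 1)"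
    unfolding sum_quads_difference[of n e, OF n e(1,2)] e(3,4)
    by (intro sum.cong refl, subst diagonal_quadratic_form)
       (auto simp: pos field_simps power2_eq_square power_numeral_reduce)
  also have "\<dots> = 5/6 * s 3 + s 1 / 6 - of_nat n * s 1"
    unfolding ssum by (simp add: sum.distrib sum_subtractf sum_distrib_left sum_divide_distrib)
  finally show "2 * c 1 1 = 5/6 * s 3 + s 1 / 6 - of_nat n * s 1" .

  have "8 * c 1 3 = 4 * c 1 3 + 4 * c 3 1"
    unfolding csym[of 3 1] by simp
  also have "\<dots> = (\<Sum>(a,b,x,y)\<in>quads n. e (of_nat a) (of_nat b) ^ 2 - e (of_nat a - of_nat b) (of_nat b) ^ 2)"
    unfolding csum ediff by (simp add: sum_distrib_left sum.distrib case_prod_unfold)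
  also have "\<dots> = (\<Sum>d | d dvd n. 7/10 * of_nat d ^ 5 + of_nat d ^ 3 / 3 - of_nat d ^ 1 / 30
      - of_nat n * of_nat d ^ 3)"
    by (subst sum_quads_difference[of n "\<lambda>a b. e a b ^ 2", OF n],
        simp only: e(1), simp only: e(2), unfold e(3,4),
        intro sum.cong refl, subst diagonal_quadratic_form)
       (auto simp: pos field_simps power_numeral_reduce)
  also have "\<dots> = 7/10 * s 5 + s 3 / 3 - s 1 / 30 - of_nat n * s 3"
    unfolding ssum by (simp add: sum.distrib sum_subtractf sum_distrib_left sum_divide_distrib)
  finally show "8 * c 1 3 = 7/10 * s 5 + s 3 / 3 - s 1 / 30 - of_nat n * s 3" .

  have "12 * c 1 5 + 14 * c 3 3 = 6 * c 1 5 + 6 * c 5 1 + 14 * c 3 3"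
    unfolding csym[of 5 1] by simp
  also have "\<dots> = (\<Sum>(a,b,x,y)\<in>quads n. e (of_nat a) (of_nat b) ^ 3 - e (of_nat a - of_nat b) (of_nat b) ^ 3)"
    unfolding csum ediff by (simp add: sum_distrib_left sum.distrib case_prod_unfold)
  also have "\<dots> = (\<Sum>d | d dvd n. 83/140 * of_nat d ^ 7 + of_nat d ^ 5 / 2 - 7/60 * of_nat d ^ 3
      + of_nat d ^ 1 / 42 - of_nat n * of_nat d ^ 5)"
    by (subst sum_quads_difference[of n "\<lambda>a b. e a b ^ 3", OF n],
        simp only: e(1), simp only: e(2), unfold e(3,4),
        intro sum.cong refl, subst diagonal_quadratic_form)
       (auto simp: pos field_simps power_numeral_reduce)
  also have "\<dots> = 83/140 * s 7 + s 5 / 2 - 7/60 * s 3 + s 1 / 42 - of_nat n * s 5"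
    unfolding ssum by (simp add: sum.distrib sum_subtractf sum_distrib_left sum_divide_distrib)
  finally show "12 * c 1 5 + 14 * c 3 3
      = 83/140 * s 7 + s 5 / 2 - 7/60 * s 3 + s 1 / 42 - of_nat n * s 5" .

  \<comment> \<open>Like \<open>e\<close>, this is an invariant of the \<open>S\<^sub>3\<close> generated by \<open>(a, b) \<mapsto> (b, a)\<close> and
    \<open>(a, b) \<mapsto> (a + b, -b)\<close>; it singles out the term \<open>a\<^sup>3 b\<^sup>3\<close>.\<close>
  define h :: "rat \<Rightarrow> rat \<Rightarrow> rat" where "h a b = ((a + b) * a * b)^2" for a b
  have h: "h a b = h b a" "h (a - b) b = h (b - a) a" "h 0 b = 0" "h a (b - a) = (b * a * (b - a))^2"
    "h a b - h (a - b) b = 4 * (a^3 * b^3)" for a b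
    by (simp_all add: h_def power_numeral_reduce algebra_simps)
  have "4 * c 3 3 = (\<Sum>(a,b,x,y)\<in>quads n. h (of_nat a) (of_nat b) - h (of_nat a - of_nat b) (of_nat b))"
    unfolding csum h(5) by (simp add: sum_distrib_left case_prod_unfold)
  also have "\<dots> = (\<Sum>d | d dvd n. (of_nat d ^ 7 - of_nat d ^ 3) / 30)"
    unfolding sum_quads_difference[of n h, OF n h(1,2)] h(3,4)
    by (intro sum.cong refl, subst diagonal_quadratic_form) (auto simp: pos)
  also have "\<dots> = (s 7 - s 3) / 30"
    unfolding ssum by (simp add: sum_subtractf flip: sum_divide_distrib)
  finally show "4 * c 3 3 = (s 7 - s 3) / 30" .
qed
section \<open>Ramanujan's differential equations\<close>

definition eisenstein2 :: "rat fps"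
  where "eisenstein2 = 1 - 24 * divisor_series 1"

definition eisenstein4 :: "rat fps"
  where "eisenstein4 = 1 + 240 * divisor_series 3"

definition eisenstein6 :: "rat fps"
  where "eisenstein6 = 1 - 504 * divisor_series 5"

lemma fps_numeral_times_nth: "(numeral k * F) $ n = numeral k * F $ n"
  for F :: "'a::comm_ring_1 fps"
  by (simp add: numeral_fps_const)

theorem ramanujan:
  "12 * q_deriv eisenstein2 = eisenstein2^2 - eisenstein4"
  "3 * q_deriv eisenstein4 = eisenstein2 * eisenstein4 - eisenstein6"
  "2 * q_deriv eisenstein6 = eisenstein2 * eisenstein6 - eisenstein4^2"
proof -
  let ?S = divisor_series
  have dist: "eisenstein2^2 = 1 - 48 * ?S 1 + 576 * (?S 1 * ?S 1)"
    "eisenstein2 * eisenstein4 = 1 - 24 * ?S 1 + 240 * ?S 3 - 5760 * (?S 1 * ?S 3)"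
    "eisenstein2 * eisenstein6 = 1 - 24 * ?S 1 - 504 * ?S 5 + 12096 * (?S 1 * ?S 5)"
    "eisenstein4^2 = 1 + 480 * ?S 3 + 57600 * (?S 3 * ?S 3)"
    by (simp_all add: eisenstein2_def eisenstein4_def eisenstein6_def power2_eq_square algebra_simps)
  show "12 * q_deriv eisenstein2 = eisenstein2^2 - eisenstein4" 
    unfolding dist unfolding eisenstein4_def eisenstein2_def
  proof (rule fps_ext)
    fix n show "(12 * q_deriv (1 - 24 * ?S 1)) $ n
      = (1 - 48 * ?S 1 + 576 * (?S 1 * ?S 1) - (1 + 240 * ?S 3)) $ n"
      using divisor_convolution(1)[of n]
      by (cases "n = 0") (simp_all add: q_deriv_nth fps_numeral_times_nth fps_mult_nth_0)
  qed
  show "3 * q_deriv eisenstein4 = eisenstein2 * eisenstein4 - eisenstein6"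
    unfolding dist unfolding eisenstein4_def eisenstein6_def
  proof (rule fps_ext)
    fix n show "(3 * q_deriv (1 + 240 * ?S 3)) $ n
      = (1 - 24 * ?S 1 + 240 * ?S 3 - 5760 * (?S 1 * ?S 3) - (1 - 504 * ?S 5)) $ n"
      using divisor_convolution(2)[of n]
      by (cases "n = 0") (simp_all add: q_deriv_nth fps_numeral_times_nth fps_mult_nth_0)
  qed
  show "2 * q_deriv eisenstein6 = eisenstein2 * eisenstein6 - eisenstein4^2"
    unfolding dist unfolding eisenstein6_def
  proof (rule fps_ext)
    fix n show "(2 * q_deriv (1 - 504 * ?S 5)) $ n
      = (1 - 24 * ?S 1 - 504 * ?S 5 + 12096 * (?S 1 * ?S 5)
         - (1 + 480 * ?S 3 + 57600 * (?S 3 * ?S 3))) $ n"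
      \<comment> \<open>The third identity also involves sums of seventh powers; the fourth
        expresses them by \<open>?S 3 * ?S 3\<close> and \<open>?S 3\<close>.\<close>
      using divisor_convolution(3,4)[of n]
      by (cases "n = 0") (simp_all add: q_deriv_nth fps_numeral_times_nth fps_mult_nth_0)
  qed
qed
section \<open>The eta function\<close>

definition euler_partial :: "nat \<Rightarrow> rat fps"
  where "euler_partial N = (\<Prod>i\<le>N. 1 - fps_X ^ Suc i)"

text \<open>The infinite product by its coefficients: the factor \<open>1 - fps_X ^ (N + 2)\<close>
  leaves coefficients up to \<open>N\<close> alone, so \<open>euler_partial n\<close> already has
  the final coefficient \<open>n\<close>.\<close>

definition euler_series :: "rat fps"
  where "euler_series = Abs_fps (\<lambda>n. euler_partial n $ n)"

lemma euler_partial_Suc: "euler_partial (Suc N) = euler_partial N - fps_X ^ Suc (Suc N) * euler_partial N"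
  by (simp add: euler_partial_def algebra_simps)

lemma euler_partial_nth:
  assumes "n \<le> N"
  shows "euler_partial N $ n = euler_series $ n"
  using assms
proof (induction N rule: dec_induct)
  case base
  then show ?case by (simp add: euler_series_def)
next
  case (step N)
  then show ?case by (simp add: euler_partial_Suc fps_X_power_mult_nth del: power_Suc)
qed

section \<open>Logarithmic derivative of the Euler product\<close>

lemma q_deriv_mult: "q_deriv (F * G) = q_deriv F * G + F * q_deriv G"
  by (simp add: q_deriv_def algebra_simps)

lemma q_deriv_diff: "q_deriv (F - G) = q_deriv F - q_deriv G"
  by (simp add: q_deriv_def algebra_simps)

lemma q_deriv_1 [simp]: "q_deriv 1 = 0"
  by (simp add: q_deriv_def)

text \<open>For positive \<open>m\<close>, the expansion of \<open>m X^m / (1 - X^m)\<close>, minus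
  the logarithmic derivative of \<open>1 - X^m\<close>.\<close>

definition lambert_term :: "nat \<Rightarrow> rat fps"
  where "lambert_term m = Abs_fps (\<lambda>n. if 0 < n \<and> m dvd n then of_nat m else 0)"

lemma lambert_term_eq:
  assumes "0 < m"
  shows "(1 - fps_X ^ m) * lambert_term m = of_nat m * fps_X ^ m"
proof (rule fps_ext)
  fix n
  show "((1 - fps_X ^ m) * lambert_term m) $ n = (of_nat m * fps_X ^ m) $ n"
    using assms
    by (cases "n < m")
       (auto simp: left_diff_distrib fps_X_power_mult_nth lambert_term_def fps_X_power_nth
          fps_of_nat[symmetric] dvd_minus_self dest: dvd_imp_le)
qed

lemma q_deriv_X_power: "q_deriv (fps_X ^ m) = of_nat m * fps_X ^ m"
  by (auto simp: fps_eq_iff q_deriv_nth fps_X_power_nth simp flip: fps_of_nat)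

lemma q_deriv_euler_partial:
  "q_deriv (euler_partial N) = - euler_partial N * (\<Sum>i\<le>N. lambert_term (Suc i))"
proof (induction N)
  have step: "q_deriv (1 - fps_X ^ Suc i) = - ((1 - fps_X ^ Suc i) * lambert_term (Suc i))" for i
    unfolding q_deriv_diff q_deriv_X_power lambert_term_eq[OF zero_less_Suc] by simp
  {
    case 0
    show ?case
      using step[of 0] by (simp add: euler_partial_def algebra_simps)
  next
    case (Suc N)
    have *: "euler_partial (Suc N) = euler_partial N * (1 - fps_X ^ Suc (Suc N))"
      by (simp add: euler_partial_def)
    show ?case
      unfolding * q_deriv_mult Suc step by (simp add: algebra_simps)
  }
qed

text \<open>For \<open>n > 0\<close>, coefficient \<open>n\<close> collects the divisors
  \<open>Suc i\<close> of \<open>n\<close>. These reach \<open>Suc N\<close>, hence the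
  bound.\<close>

lemma sum_lambert_terms_nth:
  assumes "n \<le> Suc N"
  shows "(\<Sum>i\<le>N. lambert_term (Suc i)) $ n = divisor_series 1 $ n"
proof (cases "n = 0")
  case True
  then show ?thesis by (simp add: fps_sum_nth lambert_term_def)
next
  case False
  have "(\<Sum>i\<le>N. lambert_term (Suc i)) $ n = (\<Sum>i\<le>N. if Suc i dvd n then of_nat (Suc i) else 0)"
    using False by (simp add: fps_sum_nth lambert_term_def)
  also have "\<dots> = (\<Sum>i | i \<le> N \<and> Suc i dvd n. of_nat (Suc i))"
    by (subst sum.inter_filter[symmetric]) auto
  also have "\<dots> = (\<Sum>d | d dvd n. of_nat d ^ 1)"
  proof (rule sum.reindex_bij_witness[where i = "\<lambda>d. d - 1" and j = Suc])
    fix d assume "d \<in> {d. d dvd n}"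
    then have "0 < d" "d \<le> n" "d dvd n"
      using False dvd_imp_le[of d n] dvd_pos_nat[of n d] by auto
    then show "Suc (d - 1) = d" "d - 1 \<in> {i. i \<le> N \<and> Suc i dvd n}"
      using assms by auto
  qed auto
  finally show ?thesis
    using False by (simp add: divisor_series_nth)
qed

text \<open>Coefficient \<open>n\<close> involves only coefficients up to \<open>n\<close>, where
  the partial product and the finite Lambert sum are already exact.\<close>

lemma q_deriv_euler_series: "q_deriv euler_series = - euler_series * divisor_series 1"
proof (rule fps_ext)
  fix n
  have "q_deriv euler_series $ n = q_deriv (euler_partial n) $ n"
    by (simp add: q_deriv_nth euler_partial_nth)
  also have "\<dots> = - ((euler_partial n * (\<Sum>i\<le>n. lambert_term (Suc i))) $ n)"
    by (simp add: q_deriv_euler_partial)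
  also have "(euler_partial n * (\<Sum>i\<le>n. lambert_term (Suc i))) $ n = (euler_series * divisor_series 1) $ n"
    unfolding fps_mult_nth
    by (intro sum.cong refl arg_cong2[where f = "(*)"] euler_partial_nth sum_lambert_terms_nth) auto
  finally show "q_deriv euler_series $ n = (- euler_series * divisor_series 1) $ n"
    by simp
qed

section \<open>Substituting \<open>q = t^24\<close>\<close>

lemma q_ser_nth_0 [simp]: "q_ser $ 0 = 0"
  by (simp add: q_ser_def)

text \<open>Coefficient \<open>n\<close> of the partial products is constant from
  \<open>N = n\<close> on, which gives t-adic convergence.\<close>

lemma prodinf_q_ser: "prodinf (\<lambda>n. 1 - q_ser ^ Suc n) = euler_series oo q_ser"
proof -
  have "(\<lambda>N. \<Prod>i\<le>N. 1 - q_ser ^ Suc i) \<longlonglongrightarrow> (euler_series oo q_ser)"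
  proof (rule tendsto_fpsI)
    fix n
    have "(\<Prod>i\<le>N. 1 - q_ser ^ Suc i) $ n = (euler_series oo q_ser) $ n" if "n \<le> N" for N
    proof -
      have "(\<Prod>i\<le>N. 1 - q_ser ^ Suc i) = euler_partial N oo q_ser"
        unfolding euler_partial_def fps_compose_prod_distrib[OF q_ser_nth_0]
        by (simp add: fps_compose_sub_distrib fps_compose_mult_distrib flip: fps_compose_power)
      then show ?thesis
        using that by (simp add: fps_compose_nth euler_partial_nth)
    qed
    then show "\<forall>\<^sub>F N in sequentially. (\<Prod>i\<le>N. 1 - q_ser ^ Suc i) $ n = (euler_series oo q_ser) $ n"
      by (auto simp: eventually_sequentially)
  qed
  \<comment> \<open>\<open>raw_has_prod\<close> demands a nonzero limit.\<close>
  moreover have "(euler_series oo q_ser) $ 0 \<noteq> 0"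
    by (simp add: euler_series_def euler_partial_def)
  then have "euler_series oo q_ser \<noteq> 0"
    by (metis fps_zero_nth)
  ultimately have "(\<lambda>n. 1 - q_ser ^ Suc n) has_prod (euler_series oo q_ser)"
    by (simp add: has_prod_def raw_has_prod_def)
  then show ?thesis
    by (rule has_prod_unique[symmetric])
qed

text \<open>Chain rule, used for \<open>k = 24\<close> (from q to t) and for \<open>k = l\<close>
  (from q to \<open>q^l\<close>).\<close>

lemma q_deriv_compose_X_power:
  assumes "0 < k"
  shows "q_deriv (F oo fps_X ^ k) = of_nat k * (q_deriv F oo fps_X ^ k)"
proof -
  have X0: "(fps_X ^ k :: rat fps) $ 0 = 0"
    using assms by simp
  have "q_deriv (F oo fps_X ^ k) = (fps_deriv F oo fps_X ^ k) * q_deriv (fps_X ^ k)"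
    by (simp add: q_deriv_def fps_compose_deriv[OF X0])
  also have "\<dots> = of_nat k * ((fps_X * fps_deriv F) oo fps_X ^ k)"
    unfolding q_deriv_X_power by (simp add: fps_compose_mult_distrib[OF X0] fps_X_fps_compose_startby0[OF X0] algebra_simps)
  finally show ?thesis by (simp add: q_deriv_def)
qed

lemma eta_ser_eq: "eta_ser = fps_X * (euler_series oo fps_X ^ 24)"
  unfolding eta_ser_def prodinf_q_ser by (simp add: q_ser_def)

lemma eta_ser_nonzero: "eta_ser \<noteq> 0"
proof -
  have "(euler_series oo fps_X ^ 24) $ 0 \<noteq> 0"
    by (simp add: euler_series_def euler_partial_def)
  then have "euler_series oo fps_X ^ 24 \<noteq> 0"
    by (metis fps_zero_nth)
  then show ?thesis by (simp add: eta_ser_eq)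
qed

lemma fps_compose_numeral_times:
  "c $ 0 = 0 \<Longrightarrow> (numeral k * G) oo c = numeral k * (G oo c)" for G :: "rat fps"
  by (simp add: fps_compose_mult_distrib numeral_fps_const)

text \<open>The factor \<open>t\<close> contributes 1 to the logarithmic derivative and the Euler
  product -24 times the divisor series; together this is E2.\<close>

lemma q_deriv_eta: "q_deriv eta_ser = eta_ser * (eisenstein2 oo fps_X ^ 24)"
proof -
  have X0: "(fps_X ^ 24 :: rat fps) $ 0 = 0"
    by simp
  have 1: "q_deriv (euler_series oo fps_X ^ 24)
      = - (24 * (euler_series oo fps_X ^ 24) * (divisor_series 1 oo fps_X ^ 24))"
    by (subst q_deriv_compose_X_power)
       (simp_all add: q_deriv_euler_series fps_compose_mult_distrib fps_compose_uminus)
  have 2: "eisenstein2 oo fps_X ^ 24 = 1 - 24 * (divisor_series 1 oo fps_X ^ 24)"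
    unfolding eisenstein2_def fps_compose_sub_distrib fps_compose_numeral_times[OF X0] by simp
  have 3: "q_deriv fps_X = fps_X"
    by (simp add: q_deriv_def)
  show ?thesis
    unfolding eta_ser_eq q_deriv_mult 1 2 3 by (simp add: algebra_simps)
qed

lemma E4_ser_eq: "E4_ser = eisenstein4 oo fps_X ^ 24"
  by (simp add: E4_ser_def eisenstein4_def q_ser_def divisor_series_def fps_compose_add_distrib
      fps_compose_mult_distrib numeral_fps_const)

lemma E6_ser_eq: "E6_ser = eisenstein6 oo fps_X ^ 24"
  by (simp add: E6_ser_def eisenstein6_def q_ser_def divisor_series_def fps_compose_sub_distrib
      fps_compose_mult_distrib numeral_fps_const)

text \<open>
  In terms of \<open>t\<close>, the derivation \<^const>\<open>q_deriv\<close> is \<open>t d/dt = 24 q d/dq\<close>; hence the factors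
  \<open>2, 8, 12\<close> in place of the classical \<open>1/12, 1/3, 1/2\<close>.
\<close>

definition E2_ser :: "rat fps"
  where "E2_ser = eisenstein2 oo fps_X ^ 24"

lemma ramanujan_ser:
  "q_deriv E2_ser = 2 * (E2_ser^2 - E4_ser)"
  "q_deriv E4_ser = 8 * (E2_ser * E4_ser - E6_ser)"
  "q_deriv E6_ser = 12 * (E2_ser * E6_ser - E4_ser^2)"
proof -
  have X0: "(fps_X ^ 24 :: rat fps) $ 0 = 0"
    by simp
  note num = fps_compose_numeral_times[OF X0]
  note [simp] = fps_compose_sub_distrib fps_compose_mult_distrib fps_compose_power
  \<comment> \<open>The chain-rule factor 24 is split as \<open>2 * 12\<close>, below as
    \<open>8 * 3\<close> and \<open>12 * 2\<close>, to match \<open>ramanujan\<close>.\<close>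
  have "q_deriv E2_ser = 2 * ((12 * q_deriv eisenstein2) oo fps_X ^ 24)"
    unfolding E2_ser_def num by (subst q_deriv_compose_X_power) simp_all
  then show "q_deriv E2_ser = 2 * (E2_ser^2 - E4_ser)"
    unfolding ramanujan E4_ser_eq E2_ser_def by simp
  have "q_deriv E4_ser = 8 * ((3 * q_deriv eisenstein4) oo fps_X ^ 24)"
    unfolding E4_ser_eq num by (subst q_deriv_compose_X_power) simp_all
  then show "q_deriv E4_ser = 8 * (E2_ser * E4_ser - E6_ser)"
    unfolding ramanujan E4_ser_eq E2_ser_def E6_ser_eq by simp
  have "q_deriv E6_ser = 12 * ((2 * q_deriv eisenstein6) oo fps_X ^ 24)"
    unfolding E6_ser_eq num by (subst q_deriv_compose_X_power) simp_all
  then show "q_deriv E6_ser = 12 * (E2_ser * E6_ser - E4_ser^2)"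
    unfolding ramanujan E4_ser_eq E2_ser_def E6_ser_eq by simp
qed

lemma q_deriv_q_power: "0 < l \<Longrightarrow> q_deriv (q_power l F) = of_nat l * q_power l (q_deriv F)"
  unfolding q_power_def by (rule q_deriv_compose_X_power)

text \<open>Logarithmic derivatives: eta gives E2, eta at \<open>q^l\<close> gives \<open>l\<close>
  times E2 at \<open>q^l\<close>, and the square doubles the sum.\<close>

lemma q_deriv_f_ser:
  assumes "0 < l"
  shows "q_deriv (f_ser l) = 2 * f_ser l * (E2_ser + of_nat l * q_power l E2_ser)"
proof -
  have "q_power l (eta_ser * E2_ser) = q_power l eta_ser * q_power l E2_ser"
    unfolding q_power_def by (rule fps_compose_mult_distrib) (use assms in simp)
  then have "q_deriv (q_power l eta_ser) = of_nat l * (q_power l eta_ser * q_power l E2_ser)"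
    by (simp add: q_deriv_q_power[OF assms] q_deriv_eta E2_ser_def)
  then show ?thesis
    unfolding f_ser_def power2_eq_square q_deriv_mult q_deriv_eta E2_ser_def[symmetric]
    by (simp add: algebra_simps)
qed

lemma f_ser_nonzero:
  assumes "0 < l"
  shows "f_ser l \<noteq> 0"
  using assms eta_ser_nonzero
  by (simp add: f_ser_def q_power_def fps_compose_eq_0_iff)

text \<open>This is where E4 at \<open>q^l\<close> enters.\<close>

lemma q_deriv_q_power_E2:
  assumes "0 < l"
  shows "q_deriv (q_power l E2_ser) = 2 * of_nat l * (q_power l E2_ser ^ 2 - q_power l E4_ser)"
proof -
  have X0: "(fps_X ^ l :: rat fps) $ 0 = 0"
    using assms by simp
  show ?thesis
    unfolding q_deriv_q_power[OF assms] ramanujan_ser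
    unfolding q_power_def fps_compose_numeral_times[OF X0] fps_compose_sub_distrib
      fps_compose_power[OF X0]
    by simp
qed

lemma E_ser_nonzero: "E4_ser \<noteq> 0" "E6_ser \<noteq> 0"
proof -
  have "E4_ser $ 0 \<noteq> 0" "E6_ser $ 0 \<noteq> 0"
    by (simp_all add: E4_ser_eq E6_ser_eq eisenstein4_def eisenstein6_def)
  then show "E4_ser \<noteq> 0" "E6_ser \<noteq> 0"
    by auto
qed
section \<open>Evaluation of polynomials in three variables\<close>

lemma map_poly_additive:
  assumes "f 0 = 0" "\<And>a b. f (a + b) = f a + f b"
  shows "map_poly f (p + q) = map_poly f p + map_poly f q"
  by (rule poly_eqI) (simp add: coeff_map_poly assms)

lemma poly_map_poly_scale:
  fixes c :: "'a::comm_semiring_1"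
  assumes "f 0 = 0"
  shows "poly (map_poly (\<lambda>a. c * f a) p) x = c * poly (map_poly f p) x"
proof -
  have "map_poly (\<lambda>a. c * f a) p = smult c (map_poly f p)"
    by (rule poly_eqI) (simp add: coeff_map_poly assms)
  then show ?thesis by simp
qed

lemma poly_map_poly_fun_add:
  fixes f g :: "'b::zero \<Rightarrow> 'a::comm_semiring_1"
  assumes "f 0 = 0" "g 0 = 0"
  shows "poly (map_poly (\<lambda>a. f a + g a) p) x = poly (map_poly f p) x + poly (map_poly g p) x"
proof -
  have "map_poly (\<lambda>a. f a + g a) p = map_poly f p + map_poly g p"
    by (rule poly_eqI) (simp add: coeff_map_poly assms)
  then show ?thesis by simp
qed

lemma poly_map_poly_zero:
  fixes x :: "'a::comm_semiring_1"
  shows "poly (map_poly (\<lambda>_. 0) p) x = 0"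
proof -
  have "map_poly (\<lambda>_. 0 :: 'a) p = 0"
    by (rule poly_eqI) (simp add: coeff_map_poly)
  then show ?thesis by simp
qed

definition eval_Z :: "rat poly \<Rightarrow> 'a::field_char_0 \<Rightarrow> 'a"
  where "eval_Z d z = poly (map_poly of_rat d) z"

lemma eval_YZ_eq: "eval_YZ c y z = poly (map_poly (\<lambda>d. eval_Z d z) c) y"
  by (simp add: eval_YZ_def eval_Z_def)

lemma eval_XYZ_eq: "eval_XYZ U x y z = poly (map_poly (\<lambda>c. eval_YZ c y z) U) x"
  by (simp add: eval_XYZ_def specialize_YZ_def)

lemma eval_Z_0 [simp]: "eval_Z 0 z = 0"
  by (simp add: eval_Z_def)

lemma eval_YZ_0 [simp]: "eval_YZ 0 y z = 0"
  by (simp add: eval_YZ_def)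

lemma eval_YZ_1 [simp]: "eval_YZ 1 y z = 1"
  by (simp add: eval_YZ_eq eval_Z_def)

lemma eval_Z_add: "eval_Z (p + q) z = eval_Z p z + eval_Z q z"
  by (simp add: eval_Z_def map_poly_additive of_rat_add)

lemma eval_YZ_add: "eval_YZ (p + q) y z = eval_YZ p y z + eval_YZ q y z"
  by (simp add: eval_YZ_eq map_poly_additive eval_Z_add)

lemma eval_XYZ_add: "eval_XYZ (p + q) x y z = eval_XYZ p x y z + eval_XYZ q x y z"
  by (simp add: eval_XYZ_eq map_poly_additive eval_YZ_add)

lemma eval_Z_pCons: "eval_Z (pCons a p) z = of_rat a + z * eval_Z p z"
  by (simp add: eval_Z_def map_poly_pCons)

lemma eval_YZ_pCons: "eval_YZ (pCons a p) y z = eval_Z a z + y * eval_YZ p y z"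
  by (simp add: eval_YZ_eq map_poly_pCons)

lemma eval_XYZ_pCons: "eval_XYZ (pCons a p) x y z = eval_YZ a y z + x * eval_XYZ p x y z"
  by (simp add: eval_XYZ_eq map_poly_pCons)

lemma eval_Z_smult: "eval_Z (smult a p) z = of_rat a * eval_Z p z"
  by (induction p) (simp_all add: eval_Z_pCons of_rat_mult algebra_simps)

lemma eval_YZ_smult: "eval_YZ (smult [:a:] p) y z = of_rat a * eval_YZ p y z"
  by (induction p) (simp_all add: eval_YZ_pCons eval_Z_smult algebra_simps)

lemma eval_XYZ_0 [simp]: "eval_XYZ 0 x y z = 0"
  by (simp add: eval_XYZ_eq)

lemma eval_XYZ_smult: "eval_XYZ (smult [:[:a:]:] p) x y z = of_rat a * eval_XYZ p x y z"
  by (induction p) (simp_all add: eval_XYZ_pCons eval_YZ_smult algebra_simps)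

text \<open>\<open>X\<close> is outermost, so \<open>pCons 0\<close> on each of its coefficients is
  multiplication by \<open>Y\<close>; one level deeper it is multiplication by
  \<open>Z\<close>.\<close>

lemma eval_XYZ_times_Y: "eval_XYZ (map_poly (pCons 0) p) x y z = y * eval_XYZ p x y z"
  by (induction p) (simp_all add: eval_XYZ_pCons eval_YZ_pCons map_poly_pCons algebra_simps)

lemma eval_YZ_times_Z: "eval_YZ (map_poly (pCons 0) p) y z = z * eval_YZ p y z"
  by (induction p) (simp_all add: eval_YZ_pCons eval_Z_pCons map_poly_pCons algebra_simps)

lemma eval_XYZ_times_Z: "eval_XYZ (map_poly (map_poly (pCons 0)) p) x y z = z * eval_XYZ p x y z"
  by (induction p) (simp_all add: eval_XYZ_pCons eval_YZ_times_Z map_poly_pCons algebra_simps)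

section \<open>Weighted homogeneity and Euler's relation\<close>

text \<open>The degree is rational, so that the degrees of partial derivatives need no truncated subtraction.\<close>

definition homogeneous :: "rat \<Rightarrow> rat poly poly poly \<Rightarrow> bool"
  where "homogeneous d U \<longleftrightarrow>
    (\<forall>i j k. coeff (coeff (coeff U i) j) k \<noteq> 0 \<longrightarrow> of_nat i + 2 * of_nat j + 3 * of_nat k = d)"

lemma homogeneous_of_weighted:
  assumes "weighted_homogeneous d U"
  shows "homogeneous (of_nat d) U"
  using assms unfolding homogeneous_def weighted_homogeneous_def by fastforce

lemma coeff_partial:
  "coeff (coeff (coeff (partial_X U) i) j) k = of_nat (Suc i) * coeff (coeff (coeff U (Suc i)) j) k"
  "coeff (coeff (coeff (partial_Y U) i) j) k = of_nat (Suc j) * coeff (coeff (coeff U i) (Suc j)) k"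
  "coeff (coeff (coeff (partial_Z U) i) j) k = of_nat (Suc k) * coeff (coeff (coeff U i) j) (Suc k)"
  by (simp_all add: partial_X_def partial_Y_def partial_Z_def coeff_map_poly coeff_pderiv
      of_nat_poly del: of_nat_Suc)

lemma homogeneous_partial:
  assumes "homogeneous d U"
  shows "homogeneous (d - 1) (partial_X U)" "homogeneous (d - 2) (partial_Y U)"
    "homogeneous (d - 3) (partial_Z U)"
proof -
  have U: "of_nat i + 2 * of_nat j + 3 * of_nat k = d" if "coeff (coeff (coeff U i) j) k \<noteq> 0" for i j k
    using assms that by (simp add: homogeneous_def)
  show "homogeneous (d - 1) (partial_X U)"
    unfolding homogeneous_def coeff_partial using U[of "Suc i" j k for i j k] by fastforce
  show "homogeneous (d - 2) (partial_Y U)"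
    unfolding homogeneous_def coeff_partial using U[of i "Suc j" k for i j k] by fastforce
  show "homogeneous (d - 3) (partial_Z U)"
    unfolding homogeneous_def coeff_partial using U[of i j "Suc k" for i j k] by fastforce
qed

lemma poly3_eqI:
  "(\<And>i j k. coeff (coeff (coeff U i) j) k = coeff (coeff (coeff V i) j) k) \<Longrightarrow> U = V"
  by (intro poly_eqI)

lemma partial_commute:
  "partial_Y (partial_X U) = partial_X (partial_Y U)"
  "partial_Z (partial_X U) = partial_X (partial_Z U)"
  "partial_Z (partial_Y U) = partial_Y (partial_Z U)"
  by (rule poly3_eqI; simp add: coeff_partial del: of_nat_Suc)+

lemma coeff_pCons_0_partial:
  "coeff (coeff (coeff (pCons 0 (partial_X U)) i) j) k = of_nat i * coeff (coeff (coeff U i) j) k"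
  "coeff (coeff (coeff (map_poly (pCons 0) (partial_Y U)) i) j) k = of_nat j * coeff (coeff (coeff U i) j) k"
  "coeff (coeff (coeff (map_poly (map_poly (pCons 0)) (partial_Z U)) i) j) k
    = of_nat k * coeff (coeff (coeff U i) j) k"
  by (cases i; cases j; cases k; simp add: coeff_partial coeff_map_poly del: of_nat_Suc)+

text \<open>Before evaluation, \<open>X d/dX + 2 Y d/dY + 3 Z d/dZ\<close> multiplies each monomial
  by its weight, which is \<open>d\<close> wherever the coefficient is nonzero.\<close>

lemma euler_homogeneous:
  assumes "homogeneous d U"
  shows "x * eval_XYZ (partial_X U) x y z + 2 * y * eval_XYZ (partial_Y U) x y z
    + 3 * z * eval_XYZ (partial_Z U) x y z = of_rat d * eval_XYZ U x y z"
proof -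
  have "pCons 0 (partial_X U) + smult [:[:2:]:] (map_poly (pCons 0) (partial_Y U))
      + smult [:[:3:]:] (map_poly (map_poly (pCons 0)) (partial_Z U)) = smult [:[:d:]:] U"
  proof (rule poly3_eqI)
    fix i j k
    let ?u = "coeff (coeff (coeff U i) j) k"
    have "(of_nat i + 2 * of_nat j + 3 * of_nat k) * ?u = d * ?u"
      using assms by (cases "?u = 0") (auto simp: homogeneous_def)
    then show "coeff (coeff (coeff (pCons 0 (partial_X U)
        + smult [:[:2:]:] (map_poly (pCons 0) (partial_Y U))
        + smult [:[:3:]:] (map_poly (map_poly (pCons 0)) (partial_Z U))) i) j) k
        = coeff (coeff (coeff (smult [:[:d:]:] U) i) j) k"
      by (simp add: coeff_pCons_0_partial algebra_simps)
  qed
  then have "eval_XYZ (pCons 0 (partial_X U) + smult [:[:2:]:] (map_poly (pCons 0) (partial_Y U))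
      + smult [:[:3:]:] (map_poly (map_poly (pCons 0)) (partial_Z U))) x y z
      = eval_XYZ (smult [:[:d:]:] U) x y z"
    by simp
  then show ?thesis
    by (simp add: eval_XYZ_add eval_XYZ_smult eval_XYZ_pCons eval_XYZ_times_Y eval_XYZ_times_Z
        mult.assoc)
qed

section \<open>Derivations and the chain rule\<close>

locale derivation =
  fixes D :: "'a::field_char_0 \<Rightarrow> 'a"
  assumes add: "D (a + b) = D a + D b"
    and mult: "D (a * b) = D a * b + a * D b"
    and of_rat: "D (of_rat r) = 0"
begin

lemma zero: "D 0 = 0"
  using of_rat[of 0] by simp

text \<open>Leibniz rule with non-constant coefficients, whose derivatives are \<open>g\<close>.
  Repeating it from the innermost variable outwards gives the chain rule.\<close>

lemma poly_map_poly:
  assumes "f 0 = 0" "\<And>a b. f (a + b) = f a + f b" "\<And>a. D (f a) = g a"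
  shows "D (poly (map_poly f p) x)
    = poly (map_poly g p) x + poly (map_poly f (pderiv p)) x * D x"
proof (induction p)
  case 0
  then show ?case by (simp add: zero)
next
  case (pCons a p)
  have "g 0 = 0"
    using assms(1,3) zero by metis
  with pCons show ?case
    using assms by (simp add: map_poly_pCons pderiv_pCons map_poly_additive add mult algebra_simps)
qed

lemma eval_Z: "D (eval_Z d z) = D z * eval_Z (pderiv d) z"
  unfolding eval_Z_def
  by (subst poly_map_poly[where g = "\<lambda>_. 0"]) (simp_all add: of_rat of_rat_add poly_map_poly_zero)

lemma eval_YZ:
  "D (eval_YZ c y z) = D z * eval_YZ (map_poly pderiv c) y z + D y * eval_YZ (pderiv c) y z"
  unfolding eval_YZ_eq
  by (subst poly_map_poly[OF _ _ eval_Z])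
     (simp_all add: eval_Z_add poly_map_poly_scale map_poly_map_poly comp_def)

lemma eval_XYZ:
  "D (eval_XYZ U x y z) = eval_XYZ (partial_X U) x y z * D x
    + eval_XYZ (partial_Y U) x y z * D y + eval_XYZ (partial_Z U) x y z * D z"
  unfolding eval_XYZ_eq partial_X_def partial_Y_def partial_Z_def
  by (subst poly_map_poly[OF _ _ eval_YZ])
     (simp_all add: eval_YZ_add poly_map_poly_fun_add poly_map_poly_scale map_poly_map_poly comp_def)

end

lemma eval_YZ_of_nat_mult: "eval_YZ (of_nat n * c) y z = of_nat n * eval_YZ c y z"
  by (induction n) (simp_all add: eval_YZ_add algebra_simps)

lemma specialize_YZ_pderiv: "specialize_YZ (pderiv U) y z = pderiv (specialize_YZ U y z)"
  by (rule poly_eqI)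
     (simp add: specialize_YZ_def coeff_map_poly coeff_pderiv eval_YZ_of_nat_mult del: of_nat_Suc)

text \<open>In characteristic 0 the derivative of the minimal polynomial is nonzero, of smaller
  degree and over the same field, so minimality forbids it to vanish at \<open>x\<close>.\<close>

lemma partial_X_nonzero_at_minimal_root:
  assumes deg: "0 < degree U" and lead: "lead_coeff U = 1"
    and min: "is_minimal_polynomial (rat_adjoin2 y z) x (specialize_YZ U y z)"
  shows "eval_XYZ (partial_X U) x y z \<noteq> 0"
proof
  let ?p = "specialize_YZ U y z"
  assume "eval_XYZ (partial_X U) x y z = 0"
  then have root: "poly (pderiv ?p) x = 0"
    by (simp add: eval_XYZ_def partial_X_def specialize_YZ_pderiv)
  \<comment> \<open>As \<open>U\<close> is monic, its specialization keeps a positive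
    degree.\<close>
  have "coeff ?p (degree U) = 1"
    using lead by (simp add: specialize_YZ_def coeff_map_poly)
  then have degp: "0 < degree ?p"
    using deg le_degree[of ?p "degree U"] by simp
  then have nz: "pderiv ?p \<noteq> 0"
    by (simp add: pderiv_eq_0_iff)
  have "coeff (pderiv ?p) i \<in> rat_adjoin2 y z" for i
  proof -
    have "coeff (pderiv ?p) i = eval_YZ (coeff (pderiv U) i) y z / eval_YZ 1 y z"
      unfolding specialize_YZ_pderiv[symmetric] by (simp add: specialize_YZ_def coeff_map_poly)
    then show ?thesis
      unfolding rat_adjoin2_def using eval_YZ_1[of y z] by (metis (mono_tags, lifting) mem_Collect_eq one_neq_zero)
  qed
  then have "degree ?p \<le> degree (pderiv ?p)"
    using min nz root by (simp add: is_minimal_polynomial_def)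
  then show False
    using degp by (simp add: degree_pderiv)
qed
section \<open>The modular equation\<close>

text \<open>Here \<open>y\<close>, \<open>z\<close>, \<open>P\<close> stand for E4, E6, E2,
  \<open>s\<close> for \<open>l E2(q^l) - E2\<close>, \<open>Ds\<close> for its derivative and
  \<open>G\<close> for \<open>l^2 E4(q^l)\<close>.\<close>

lemma eliminate_second_order:
  fixes f y z P s Ds G l df d4 d6 dff d44 d66 df4 df6 d46 :: "'a::field_char_0"
  defines "Df \<equiv> 2 * f * (2 * P + s)" and "Dy \<equiv> 8 * (P * y - z)" and "Dz \<equiv> 12 * (P * z - y^2)"
  assumes euler: "f * df + 2 * y * d4 + 3 * z * d6 = 0"
    and euler_f: "f * dff + 2 * y * df4 + 3 * z * df6 = l * df"
    and euler_4: "f * df4 + 2 * y * d44 + 3 * z * d46 = (l - 1) * d4"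
    and euler_6: "f * df6 + 2 * y * d46 + 3 * z * d66 = (l - 2) * d6"
    and s: "f * df * s = 4 * d4 * z + 6 * d6 * y^2"
    and Ds: "Df * df * s + f * (dff * Df + df4 * Dy + df6 * Dz) * s + f * df * Ds
      = 4 * (df4 * Df + d44 * Dy + d46 * Dz) * z + 4 * d4 * Dz
        + 6 * (df6 * Df + d46 * Dy + d66 * Dz) * y^2 + 12 * d6 * y * Dy"
    and G: "2 * G = 2 * s^2 + 4 * s * P + 2 * y - Ds"
  shows "G * (f^2 * y * z * df^3) = - (
      24 * (3 * z * d6^2 * df4 + d46 * df^2 * f) * y^6
      + 12 * (9 * z^2 * d6^2 * df6 - 3 * z * d6^2 * df * l + 6 * z * d6 * df * df6 * f
              - d6 * df^2 * l * f + df^2 * df6 * f^2 - 6 * z * d6^2 * df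
              + 2 * d6 * df^2 * f) * y^5
      + 96 * y^4 * z^2 * d4 * d6 * df4
      + 4 * z * (36 * z^2 * d4 * d6 * df6 - 12 * z * d4 * d6 * df * l
              + 12 * z * d4 * df * df6 * f - 12 * z * d46 * df^2 * f
              + 12 * z * d6 * df * df4 * f - 24 * z * d4 * d6 * df - 5 * d4 * df^2 * f) * y^3
      + z * (32 * z^2 * d4^2 * df4 - 42 * z * d6 * df^2 * f + df^3 * f^2) * y^2
      + 16 * z^3 * d4 * (3 * z * d4 * df6 - d4 * df * l + 2 * df * df4 * f
              - 2 * d4 * df) * y
      + 24 * z^4 * d46 * f * df^2 - 8 * z^3 * d4 * l * f * df^2
      + 8 * z^3 * df4 * f^2 * df^2 + 8 * z^3 * d4 * f * df^2)" (is "_ = - ?M")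
proof -
  \<comment> \<open>Polynomial names for \<open>f * df * s\<close> (\<open>N\<close>) and
    \<open>df * Df / 2\<close> (\<open>W\<close>); by Euler's relations \<open>A\<close>,
    \<open>B\<close>, \<open>C\<close> are \<open>f * dff\<close>, \<open>2 * y * d44\<close>,
    \<open>3 * z * d66\<close>.\<close>
  define N where "N = 4 * d4 * z + 6 * d6 * y^2"
  define W where "W = 2 * P * f * df + N"
  define A where "A = l * df - 2 * y * df4 - 3 * z * df6"
  define B where "B = (l - 1) * d4 - f * df4 - 3 * z * d46"
  define C where "C = (l - 2) * d6 - f * df6 - 2 * y * d46"
  have sN: "f * df * s = N"
    using s by (simp add: N_def)
  have DfW: "df * Df = 2 * W"
    unfolding Df_def W_def sN[symmetric] by (simp add: algebra_simps)
  have A: "f * dff = A" and B: "2 * y * d44 = B" and C: "3 * z * d66 = C"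
    using euler_f euler_4 euler_6 by (simp_all add: A_def B_def C_def algebra_simps)
  define S where "S = 2 * y * z * df * N * W + 2 * y * z * A * N * W
      + f * y * z * df * N * (df4 * Dy + df6 * Dz)"
  define R where "R = 8 * f * y * z^2 * df * df4 * W + 2 * f * z^2 * df^2 * B * Dy
      + 4 * f * y * z^2 * df^2 * d46 * Dz + 4 * f * y * z * df^2 * d4 * Dz
      + 12 * f * y^3 * z * df * df6 * W + 6 * f * y^3 * z * df^2 * d46 * Dy
      + 2 * f * y^3 * df^2 * C * Dz + 12 * f * y^2 * z * df^2 * d6 * Dy"
  \<comment> \<open>In the multiplier, \<open>f\<close>, \<open>y\<close>, \<open>z\<close> serve to
    replace the second derivatives and \<open>df^2\<close> to replace \<open>s\<close> and
    \<open>Df\<close>.\<close>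
  have S: "f * y * z * df^2 * (Df * df * s + f * (dff * Df + df4 * Dy + df6 * Dz) * s) = S"
  proof -
    have "f * y * z * df^2 * (Df * df * s + f * (dff * Df + df4 * Dy + df6 * Dz) * s)
        = y * z * df * (f * df * s) * (df * Df) + y * z * (f * dff) * (f * df * s) * (df * Df)
          + f * y * z * df * (f * df * s) * (df4 * Dy + df6 * Dz)"
      by (simp add: power2_eq_square algebra_simps)
    then show ?thesis
      unfolding sN DfW A S_def by (simp add: algebra_simps)
  qed
  have R: "f * y * z * df^2 * (4 * (df4 * Df + d44 * Dy + d46 * Dz) * z + 4 * d4 * Dz
        + 6 * (df6 * Df + d46 * Dy + d66 * Dz) * y^2 + 12 * d6 * y * Dy) = R"
  proof -
    have "f * y * z * df^2 * (4 * (df4 * Df + d44 * Dy + d46 * Dz) * z + 4 * d4 * Dz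
        + 6 * (df6 * Df + d46 * Dy + d66 * Dz) * y^2 + 12 * d6 * y * Dy)
      = 4 * f * y * z^2 * df * df4 * (df * Df) + 2 * f * z^2 * df^2 * (2 * y * d44) * Dy
      + 4 * f * y * z^2 * df^2 * d46 * Dz + 4 * f * y * z * df^2 * d4 * Dz
      + 6 * f * y^3 * z * df * df6 * (df * Df) + 6 * f * y^3 * z * df^2 * d46 * Dy
      + 2 * f * y^3 * df^2 * (3 * z * d66) * Dz + 12 * f * y^2 * z * df^2 * d6 * Dy"
      by (simp add: power2_eq_square power3_eq_cube algebra_simps)
    then show ?thesis
      unfolding DfW B C R_def by (simp add: algebra_simps)
  qed
  have "f * y * z * df^2 * (f * df * Ds) = R - S"
    unfolding R[symmetric] S[symmetric] Ds[symmetric] by (simp add: algebra_simps)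
  moreover have "2 * (G * (f^2 * y * z * df^3))
      = 2 * y * z * df * (f * df * s)^2 + 4 * P * y * z * f * df^2 * (f * df * s)
        + 2 * y^2 * z * f^2 * df^3 - f * y * z * df^2 * (f * df * Ds)"
  proof -
    have "2 * (G * (f^2 * y * z * df^3)) = (2 * G) * (f^2 * y * z * df^3)"
      by simp
    then show ?thesis
      unfolding G by (simp add: power2_eq_square power3_eq_cube algebra_simps)
  qed
  ultimately have "2 * (G * (f^2 * y * z * df^3))
      = 2 * y * z * df * N^2 + 4 * P * y * z * f * df^2 * N
        + 2 * y^2 * z * f^2 * df^3 - (R - S)"
    by (simp add: sN)
  \<comment> \<open>A polynomial identity: \<open>P\<close> drops out, and only a multiple of
    Euler's relation for \<open>U\<close> remains beside \<open>- 2 * ?M\<close>.\<close>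
  also have "\<dots> = 2 * (- ?M) + 4 * f * y^2 * z * df^2 * (f * df + 2 * y * d4 + 3 * z * d6)"
    unfolding R_def S_def A_def B_def C_def W_def N_def Dy_def Dz_def
    by (simp add: power_numeral_reduce algebra_simps)
  finally show ?thesis
    unfolding euler mult_zero_right add_0_right
    by (rule mult_left_cancel[THEN iffD1, rotated]) simp
qed

text \<open>The extension of \<open>q_deriv\<close> to the field of Laurent series, where the
  polynomials are evaluated.\<close>

lemma derivation_fls: "derivation (\<lambda>F :: rat fls. fls_X * fls_deriv F)"
proof
  fix r :: rat
  have "(of_rat r :: rat fls) = fls_const r"
  proof (cases r)
    case (Fract a b)
    then show ?thesis
      by (simp add: Fract_of_int_quotient of_rat_divide fls_const_divide_const[symmetric]
          fls_of_int[symmetric])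
  qed
  then show "fls_X * fls_deriv (of_rat r :: rat fls) = 0"
    by simp
qed (simp_all add: algebra_simps)

lemma fls_X_deriv_fps_to_fls: "fls_X * fls_deriv (fps_to_fls F) = fps_to_fls (q_deriv F)"
  by (simp add: fls_deriv_fps_to_fls q_deriv_def fls_times_fps_to_fls)

theorem proposition4p5:
  fixes l :: nat
    and U :: "rat poly poly poly"
    and f E4 E6 E4t df d4 d6 df4 df6 d46 M :: "rat fls"
  assumes "prime l" and "[l = 11] (mod 12)"
    and "modular_polynomial l U"
    and "f = fps_to_fls (f_ser l)"
    and "E4 = fps_to_fls E4_ser"
    and "E6 = fps_to_fls E6_ser"
    and "E4t = fps_to_fls (q_power l E4_ser)"
    and "df = eval_XYZ (partial_X U) f E4 E6"
    and "d4 = eval_XYZ (partial_Y U) f E4 E6"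
    and "d6 = eval_XYZ (partial_Z U) f E4 E6"
    and "df4 = eval_XYZ (partial_X (partial_Y U)) f E4 E6"
    and "df6 = eval_XYZ (partial_X (partial_Z U)) f E4 E6"
    and "d46 = eval_XYZ (partial_Y (partial_Z U)) f E4 E6"
    and "M =
      24 * (3 * E6 * d6^2 * df4 + d46 * df^2 * f) * E4^6
      + 12 * (9 * E6^2 * d6^2 * df6 - 3 * E6 * d6^2 * df * of_nat l + 6 * E6 * d6 * df * df6 * f
              - d6 * df^2 * of_nat l * f + df^2 * df6 * f^2 - 6 * E6 * d6^2 * df
              + 2 * d6 * df^2 * f) * E4^5
      + 96 * E4^4 * E6^2 * d4 * d6 * df4
      + 4 * E6 * (36 * E6^2 * d4 * d6 * df6 - 12 * E6 * d4 * d6 * df * of_nat l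
              + 12 * E6 * d4 * df * df6 * f - 12 * E6 * d46 * df^2 * f
              + 12 * E6 * d6 * df * df4 * f - 24 * E6 * d4 * d6 * df - 5 * d4 * df^2 * f) * E4^3
      + E6 * (32 * E6^2 * d4^2 * df4 - 42 * E6 * d6 * df^2 * f + df^3 * f^2) * E4^2
      + 16 * E6^3 * d4 * (3 * E6 * d4 * df6 - d4 * df * of_nat l + 2 * df * df4 * f
              - 2 * d4 * df) * E4
      + 24 * E6^4 * d46 * f * df^2 - 8 * E6^3 * d4 * of_nat l * f * df^2
      + 8 * E6^3 * df4 * f^2 * df^2 + 8 * E6^3 * d4 * f * df^2"
  shows "E4t = - (M / (of_nat l ^ 2 * f^2 * E4 * E6 * df^3))"
proof -
  have l: "0 < l"
    using \<open>prime l\<close> by (rule prime_gt_0_nat)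
  note f = assms(4) and E4 = assms(5) and E6 = assms(6) and E4t = assms(7)
    and partials = assms(8-13)
  have deg: "degree U = l + 1" and lead: "lead_coeff U = 1" and root: "eval_XYZ U f E4 E6 = 0"
    and min: "is_minimal_polynomial (rat_adjoin2 E4 E6) f (specialize_YZ U E4 E6)"
    and "weighted_homogeneous (l + 1) U"
    using assms(3) unfolding modular_polynomial_def Let_def f E4 E6 by blast+
  then have hom: "homogeneous (of_nat (l + 1)) U"
    by (intro homogeneous_of_weighted)
  have nz: "f \<noteq> 0" "E4 \<noteq> 0" "E6 \<noteq> 0" "df \<noteq> 0"
    using f_ser_nonzero[OF l] E_ser_nonzero partial_X_nonzero_at_minimal_root[OF _ lead min]
    by (simp_all add: f E4 E6 partials deg)

  define D where "D = (\<lambda>F :: rat fls. fls_X * fls_deriv F)"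
  interpret derivation D
    unfolding D_def by (rule derivation_fls)
  have D_fps: "D (fps_to_fls F) = fps_to_fls (q_deriv F)" for F
    unfolding D_def by (rule fls_X_deriv_fps_to_fls)
  have D_num: "D (numeral k) = 0" for k
    using of_rat[of "numeral k"] by simp
  define P where "P = fps_to_fls E2_ser"
  define Pt where "Pt = fps_to_fls (q_power l E2_ser)"
  define L where "L = (of_nat l :: rat fls)"
  define s where "s = L * Pt - P"
  have DE4: "D E4 = 8 * (P * E4 - E6)" and DE6: "D E6 = 12 * (P * E6 - E4^2)"
    and DP: "D P = 2 * (P^2 - E4)"
    by (simp_all add: E4 E6 P_def D_fps ramanujan_ser fls_times_fps_to_fls fps_to_fls_power)
  have DPt: "D Pt = 2 * L * (Pt^2 - E4t)"
    by (simp add: Pt_def E4t L_def D_fps q_deriv_q_power_E2[OF l] fls_times_fps_to_fls fps_to_fls_power)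
  have Df: "D f = 2 * f * (2 * P + s)"
    by (simp add: f Pt_def P_def L_def s_def D_fps q_deriv_f_ser[OF l] fls_times_fps_to_fls)
  have DL: "D L = 0"
    using of_rat[of "of_nat l"] by (simp add: L_def)

  define dff where "dff = eval_XYZ (partial_X (partial_X U)) f E4 E6"
  define d44 where "d44 = eval_XYZ (partial_Y (partial_Y U)) f E4 E6"
  define d66 where "d66 = eval_XYZ (partial_Z (partial_Z U)) f E4 E6"
  \<comment> \<open>The right side is 0 because \<open>U\<close> vanishes at
    \<open>(f, E4, E6)\<close>. The first partial derivatives have weights \<open>l\<close>,
    \<open>l - 1\<close>, \<open>l - 2\<close>.\<close>
  have euler: "f * df + 2 * E4 * d4 + 3 * E6 * d6 = 0"
    using euler_homogeneous[OF hom, of f E4 E6] by (simp add: partials root)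
  have euler_f: "f * dff + 2 * E4 * df4 + 3 * E6 * df6 = L * df"
    using euler_homogeneous[OF homogeneous_partial(1)[OF hom], of f E4 E6]
    by (simp add: partials dff_def partial_commute L_def)
  have euler_4: "f * df4 + 2 * E4 * d44 + 3 * E6 * d46 = (L - 1) * d4"
    using euler_homogeneous[OF homogeneous_partial(2)[OF hom], of f E4 E6]
    by (simp add: partials d44_def partial_commute L_def of_rat_diff)
  have euler_6: "f * df6 + 2 * E4 * d46 + 3 * E6 * d66 = (L - 2) * d6"
    using euler_homogeneous[OF homogeneous_partial(3)[OF hom], of f E4 E6]
    by (simp add: partials d66_def L_def of_rat_diff)
  have Ddf: "D df = dff * D f + df4 * D E4 + df6 * D E6"
    and Dd4: "D d4 = df4 * D f + d44 * D E4 + d46 * D E6"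
    and Dd6: "D d6 = df6 * D f + d46 * D E4 + d66 * D E6"
    by (simp_all add: partials dff_def d44_def d66_def eval_XYZ partial_commute)

  have s: "f * df * s = 4 * d4 * E6 + 6 * d6 * E4^2"
  proof -
    have "df * D f + d4 * D E4 + d6 * D E6 = 0"
      using eval_XYZ[of U f E4 E6] by (simp add: root zero partials)
    \<comment> \<open>The multiple of \<open>P\<close> is exactly Euler's expression for
      \<open>U\<close>, so E2 itself disappears.\<close>
    then have "2 * (f * df * s - (4 * d4 * E6 + 6 * d6 * E4^2))
        + 4 * P * (f * df + 2 * E4 * d4 + 3 * E6 * d6) = 0"
      unfolding Df DE4 DE6 by (simp add: algebra_simps)
    then have "f * df * s - (4 * d4 * E6 + 6 * d6 * E4^2) = 0"
      unfolding euler mult_zero_right add_0_right mult_eq_0_iff by simp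
    then show ?thesis
      by simp
  qed
  have "D (f * df * s) = D (4 * d4 * E6 + 6 * d6 * (E4 * E4))"
    unfolding s by (simp add: power2_eq_square)
  then have Ds: "D f * df * s + f * (dff * D f + df4 * D E4 + df6 * D E6) * s + f * df * D s
      = 4 * (df4 * D f + d44 * D E4 + d46 * D E6) * E6 + 4 * d4 * D E6
        + 6 * (df6 * D f + d46 * D E4 + d66 * D E6) * E4^2 + 12 * d6 * E4 * D E4"
    unfolding add mult D_num Ddf Dd4 Dd6 by (simp add: power2_eq_square algebra_simps)
  have "D L * Pt + L * D Pt = D s + D P"
    unfolding mult[symmetric] add[symmetric] s_def by simp
  then have "D s = 2 * L^2 * (Pt^2 - E4t) - 2 * (P^2 - E4)"
    unfolding DL DPt DP by (simp add: power2_eq_square algebra_simps)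
  \<comment> \<open>\<open>L * Pt = s + P\<close> turns \<open>L^2 * Pt^2 - P^2\<close> into
    \<open>s^2 + 2 * s * P\<close>. The \<open>L^2\<close> at \<open>E4t\<close> has one factor from
    \<open>s\<close> and one from \<open>DPt\<close>.\<close>
  then have G: "2 * (L^2 * E4t) = 2 * s^2 + 4 * s * P + 2 * E4 - D s"
    unfolding s_def by (simp add: power2_eq_square algebra_simps)

  have "L^2 * E4t * (f^2 * E4 * E6 * df^3) = - M"
    unfolding assms(14) L_def[symmetric]
    by (rule eliminate_second_order[OF euler euler_f euler_4 euler_6 s Ds[unfolded Df DE4 DE6] G])
  moreover have "L \<noteq> 0"
    using l by (simp add: L_def)
  ultimately show ?thesis
    unfolding L_def[symmetric] using nz by (simp add: field_simps)
qed

end
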